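(* Let $(X,d)$ and $(Y,\rho)$ be compact metric spaces, and let $f_{1,\infty}=\{f_i\}_{i=1}^\infty$ and $g_{1,\infty}=\{g_i\}_{i=1}^\infty$ be sequences of continuous self-maps on $X$ and $Y$, respectively. Equip $X\times Y$ with the metric $\mathbf d((x_1,y_1),(x_2,y_2))=\max\{d(x_1,x_2),\rho(y_1,y_2)\}$ and let $f_{1,\infty}\times g_{1,\infty}=\{f_i\times g_i\}_{i=1}^\infty$, where $(f_i\times g_i)(x,y)=(f_i(x),g_i(y))$. Then for all nonempty $Z\subseteq X$, $W\subseteq Y$ and every $\theta\in[0,1]$, \[ \underline{h}_{\mathrm{top}}(f_{1,\infty}\times g_{1,\infty},Z\times W,\theta)\le\underline{h}_{\mathrm{top}}(f_{1,\infty},Z,\theta)+h(g_{1,\infty};W), \] \[ \overline{h}_{\mathrm{top}}(f_{1,\infty}\times g_{1,\infty},Z\times W,\theta)\le\overline{h}_{\mathrm{top}}(f_{1,\infty},Z,\theta)+h(g_{1,\infty};W). \]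
   Context: Intermediate topological entropies. Let $X$ be a compact topological space and $f_{1,\infty}=\{f_i\}_{i=1}^\infty$ a sequence of continuous maps $X\to X$. Put $f_i^0=\mathrm{id}_X$ and $f_i^j=f_{i+j-1}\circ\cdots\circ f_{i+1}\circ f_i$ for $j\ge1$. For a finite open cover $\mathcal U$ of $X$ and $m\in\mathbb N=\{1,2,\dots\}$, a string of length $m(\mathbf U)=m$ is an element $\mathbf U=(U_0,\dots,U_{m-1})\in\mathcal S_m(\mathcal U):=\mathcal U^m$, and $X(\mathbf U)=\{x\in X: f_1^j(x)\in U_j,\ 0\le j\le m-1\}$. For $Z\subseteq X$, $\alpha\ge0$, $\theta\in[0,1]$, $N\in\mathbb N$ let \[ M(Z,\alpha,\mathcal U,N,\theta)=\inf_{\mathcal G}\sum_{\mathbf U\in\mathcal G}e^{-\alpha m(\mathbf U)}, \] the infimum over all finite or countable collections $\mathcal G\subseteq\bigcup_{N\le m<N/\theta+1}\mathcal S_m(\mathcal U)$ with $Z\subseteq\bigcup_{\mathbf U\in\mathcal G}X(\mathbf U)$ (for $\theta=0$, $N/\theta=+\infty$). Let $\underline m(Z,\alpha,\mathcal U,\theta)=\liminf_{N\to\infty}M(Z,\alpha,\mathcal U,N,\theta)$ and $\overline m(Z,\alpha,\mathcal U,\theta)=\limsup_{N\to\infty}M(Z,\alpha,\mathcal U,N,\theta)$. Set $\underline h_{\mathrm{top}}(f_{1,\infty},Z,\mathcal U,\theta)=\inf\{\alpha\ge0:\underline m(Z,\alpha,\mathcal U,\theta)=0\}$, $\overline h_{\mathrm{top}}(f_{1,\infty},Z,\mathcal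 U,\theta)=\inf\{\alpha\ge0:\overline m(Z,\alpha,\mathcal U,\theta)=0\}$. The lower and upper $\theta$-intermediate topological entropies $\underline h_{\mathrm{top}}(f_{1,\infty},Z,\theta)$ and $\overline h_{\mathrm{top}}(f_{1,\infty},Z,\theta)$, with values in $[0,\infty]$, are the suprema of these quantities over all finite open covers $\mathcal U$ of $X$. Classical topological entropy on a subset: for a sequence $g_{1,\infty}$ of continuous self-maps of a compact metric space $(Y,\rho)$ and nonempty $W\subseteq Y$, put $\rho_n(x,y)=\max_{0\le j\le n-1}\rho(g_1^j(x),g_1^j(y))$, let $r_n(g_{1,\infty},W,\varepsilon)$ be the minimal cardinality of a set $E\subseteq Y$ such that every $y\in W$ has some $x\in E$ with $\rho_n(x,y)\le\varepsilon$, and $h(g_{1,\infty};W)=\lim_{\varepsilon\to0}\limsup_{n\to\infty}\frac1n\log r_n(g_{1,\infty},W,\varepsilon)\in[0,\infty]$. *)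

theory Defs
  imports "HOL-Analysis.Analysis"
begin

text \<open>
  Spaces are carrier-based. A sequence of maps is a function on \<^typ>\<open>nat\<close> used at the
  indices \<open>1, 2, \<dots>\<close>; the value at \<open>0\<close> plays no role. The term \<open>seq_iter f i j\<close> is
  \<open>f (i + j - 1) \<circ> \<dots> \<circ> f (i + 1) \<circ> f i\<close>.
\<close>

primrec seq_iter :: "(nat \<Rightarrow> 'a \<Rightarrow> 'a) \<Rightarrow> nat \<Rightarrow> nat \<Rightarrow> 'a \<Rightarrow> 'a" where
  "seq_iter f i 0 = id"
| "seq_iter f i (Suc j) = f (i + j) \<circ> seq_iter f i j"

definition finite_open_cover :: "'a topology \<Rightarrow> 'a set set \<Rightarrow> bool" where
  "finite_open_cover T \<U> \<longleftrightarrow> finite \<U> \<and> (\<forall>U\<in>\<U>. openin T U) \<and> \<Union>\<U> = topspace T"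

text \<open>Strings over a cover are lists; the length of a string is its list length.\<close>

definition strings :: "'a set set \<Rightarrow> nat \<Rightarrow> 'a set list set" where
  "strings \<U> m = {\<sigma>. length \<sigma> = m \<and> set \<sigma> \<subseteq> \<U>}"

definition string_set :: "'a topology \<Rightarrow> (nat \<Rightarrow> 'a \<Rightarrow> 'a) \<Rightarrow> 'a set list \<Rightarrow> 'a set" where
  "string_set T f \<sigma> = {x \<in> topspace T. \<forall>j<length \<sigma>. seq_iter f 1 j x \<in> \<sigma> ! j}"

text \<open>
  The case \<open>\<theta> = 0\<close>, where there is no upper bound on the length, is separate because
  \<open>N / 0 = 0\<close> in HOL.
\<close>

definition admissible_strings :: "'a set set \<Rightarrow> nat \<Rightarrow> real \<Rightarrow> 'a set list set" where
  "admissible_strings \<U> N \<theta> =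
     (\<Union>m\<in>{m. N \<le> m \<and> (\<theta> = 0 \<or> real m < real N / \<theta> + 1)}. strings \<U> m)"

definition covering_mass ::
    "'a topology \<Rightarrow> (nat \<Rightarrow> 'a \<Rightarrow> 'a) \<Rightarrow> 'a set \<Rightarrow> real \<Rightarrow> 'a set set \<Rightarrow> nat \<Rightarrow> real \<Rightarrow> ennreal" where
  "covering_mass T f Z \<alpha> \<U> N \<theta> =
     (INF \<G>\<in>{\<G>. countable \<G> \<and> \<G> \<subseteq> admissible_strings \<U> N \<theta> \<and> Z \<subseteq> (\<Union>\<sigma>\<in>\<G>. string_set T f \<sigma>)}.
        \<Sum>\<^sub>\<infinity>\<sigma>\<in>\<G>. ennreal (exp (- \<alpha> * real (length \<sigma>))))"

definition lower_mass ::
    "'a topology \<Rightarrow> (nat \<Rightarrow> 'a \<Rightarrow> 'a) \<Rightarrow> 'a set \<Rightarrow> real \<Rightarrow> 'a set set \<Rightarrow> real \<Rightarrow> ennreal" where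
  "lower_mass T f Z \<alpha> \<U> \<theta> = liminf (\<lambda>N. covering_mass T f Z \<alpha> \<U> N \<theta>)"

definition upper_mass ::
    "'a topology \<Rightarrow> (nat \<Rightarrow> 'a \<Rightarrow> 'a) \<Rightarrow> 'a set \<Rightarrow> real \<Rightarrow> 'a set set \<Rightarrow> real \<Rightarrow> ennreal" where
  "upper_mass T f Z \<alpha> \<U> \<theta> = limsup (\<lambda>N. covering_mass T f Z \<alpha> \<U> N \<theta>)"

definition lower_entropy_cover ::
    "'a topology \<Rightarrow> (nat \<Rightarrow> 'a \<Rightarrow> 'a) \<Rightarrow> 'a set \<Rightarrow> 'a set set \<Rightarrow> real \<Rightarrow> ereal" where
  "lower_entropy_cover T f Z \<U> \<theta> = (INF \<alpha>\<in>{\<alpha>. 0 \<le> \<alpha> \<and> lower_mass T f Z \<alpha> \<U> \<theta> = 0}. ereal \<alpha>)"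

definition upper_entropy_cover ::
    "'a topology \<Rightarrow> (nat \<Rightarrow> 'a \<Rightarrow> 'a) \<Rightarrow> 'a set \<Rightarrow> 'a set set \<Rightarrow> real \<Rightarrow> ereal" where
  "upper_entropy_cover T f Z \<U> \<theta> = (INF \<alpha>\<in>{\<alpha>. 0 \<le> \<alpha> \<and> upper_mass T f Z \<alpha> \<U> \<theta> = 0}. ereal \<alpha>)"

definition lower_entropy ::
    "'a topology \<Rightarrow> (nat \<Rightarrow> 'a \<Rightarrow> 'a) \<Rightarrow> 'a set \<Rightarrow> real \<Rightarrow> ereal" where
  "lower_entropy T f Z \<theta> = (SUP \<U>\<in>{\<U>. finite_open_cover T \<U>}. lower_entropy_cover T f Z \<U> \<theta>)"

definition upper_entropy ::
    "'a topology \<Rightarrow> (nat \<Rightarrow> 'a \<Rightarrow> 'a) \<Rightarrow> 'a set \<Rightarrow> real \<Rightarrow> ereal" where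
  "upper_entropy T f Z \<theta> = (SUP \<U>\<in>{\<U>. finite_open_cover T \<U>}. upper_entropy_cover T f Z \<U> \<theta>)"

text \<open>
  Classical entropy on a subset \<open>W\<close> of a compact metric space \<open>(Y, \<rho>)\<close>. The case \<open>n = 0\<close>,
  where \<^const>\<open>Max\<close> of the empty set is unspecified, does not affect the upper limit.
\<close>

definition bowen_dist ::
    "('a \<Rightarrow> 'a \<Rightarrow> real) \<Rightarrow> (nat \<Rightarrow> 'a \<Rightarrow> 'a) \<Rightarrow> nat \<Rightarrow> 'a \<Rightarrow> 'a \<Rightarrow> real" where
  "bowen_dist \<rho> g n x y = Max ((\<lambda>j. \<rho> (seq_iter g 1 j x) (seq_iter g 1 j y)) ` {..<n})"

text \<open>
  Only finite spanning sets are considered, since \<^const>\<open>card\<close> is \<open>0\<close> on infinite sets. By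
  compactness, a finite one exists for every \<open>\<epsilon> > 0\<close> and \<open>n \<ge> 1\<close>.
\<close>

definition spanning_number ::
    "'a set \<Rightarrow> ('a \<Rightarrow> 'a \<Rightarrow> real) \<Rightarrow> (nat \<Rightarrow> 'a \<Rightarrow> 'a) \<Rightarrow> 'a set \<Rightarrow> nat \<Rightarrow> real \<Rightarrow> nat" where
  "spanning_number Y \<rho> g W n \<epsilon> =
     (INF E\<in>{E. finite E \<and> E \<subseteq> Y \<and> (\<forall>y\<in>W. \<exists>x\<in>E. bowen_dist \<rho> g n x y \<le> \<epsilon>)}. card E)"

definition classical_entropy ::
    "'a set \<Rightarrow> ('a \<Rightarrow> 'a \<Rightarrow> real) \<Rightarrow> (nat \<Rightarrow> 'a \<Rightarrow> 'a) \<Rightarrow> 'a set \<Rightarrow> ereal" where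
  "classical_entropy Y \<rho> g W =
     Lim (at_right 0)
       (\<lambda>\<epsilon>. limsup (\<lambda>n. ereal (1 / real n * ln (real (spanning_number Y \<rho> g W n \<epsilon>)))))"

text \<open>The library's \<^const>\<open>prod_dist\<close> is Euclidean, so the maximum metric is defined here.\<close>

definition max_dist ::
    "('a \<Rightarrow> 'a \<Rightarrow> real) \<Rightarrow> ('b \<Rightarrow> 'b \<Rightarrow> real) \<Rightarrow> 'a \<times> 'b \<Rightarrow> 'a \<times> 'b \<Rightarrow> real" where
  "max_dist d \<rho> p q = max (d (fst p) (fst q)) (\<rho> (snd p) (snd q))"

lemma Metric_space_max_dist:
  assumes "Metric_space X d" "Metric_space Y \<rho>"
  shows "Metric_space (X \<times> Y) (max_dist d \<rho>)"
proof -
  interpret X: Metric_space X d by fact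
  interpret Y: Metric_space Y \<rho> by fact
  show ?thesis
  proof
    fix p q
    show "0 \<le> max_dist d \<rho> p q"
      by (simp add: max_dist_def le_max_iff_disj)
    show "max_dist d \<rho> p q = max_dist d \<rho> q p"
      by (simp add: max_dist_def X.commute Y.commute)
  next
    fix p q assume pq: "p \<in> X \<times> Y" "q \<in> X \<times> Y"
    have "max_dist d \<rho> p q = 0 \<longleftrightarrow> d (fst p) (fst q) = 0 \<and> \<rho> (snd p) (snd q) = 0"
      using X.nonneg[of "fst p" "fst q"] Y.nonneg[of "snd p" "snd q"]
      unfolding max_dist_def by linarith
    then show "max_dist d \<rho> p q = 0 \<longleftrightarrow> p = q"
      using pq by (auto simp: prod_eq_iff)
  next
    fix p q r assume "p \<in> X \<times> Y" "q \<in> X \<times> Y" "r \<in> X \<times> Y"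
    then show "max_dist d \<rho> p r \<le> max_dist d \<rho> p q + max_dist d \<rho> q r"
      using X.triangle[of "fst p" "fst q" "fst r"] Y.triangle[of "snd p" "snd q" "snd r"]
      by (auto simp: max_dist_def)
  qed
qed

end

theory Submission
  imports Defs
begin

text \<open>
  Given a finite open cover \<open>\<V>\<close> of the product, a Lebesgue number yields a cover \<open>\<U>\<close> of \<open>X\<close> by
  balls and an \<open>\<epsilon> > 0\<close> such that each \<open>U \<times> {y'. \<rho> y y' \<le> \<epsilon>}\<close> lies in a member of \<open>\<V>\<close>. A family
  of strings over \<open>\<U>\<close> covering \<open>Z\<close> and \<open>(m, \<epsilon>)\<close>-spanning sets for \<open>W\<close> combine to a family of
  strings over \<open>\<V>\<close> covering \<open>Z \<times> W\<close>. String lengths are preserved, so the length window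
  depending on \<open>\<theta>\<close> is respected, and a string of length \<open>m\<close> is replaced by at most \<open>exp (c * m)\<close>
  strings whenever \<open>c\<close> exceeds the exponential growth rate of the spanning numbers at scale \<open>\<epsilon>\<close>
  and \<open>m\<close> is large. Increasing \<open>\<alpha>\<close> by \<open>c\<close> compensates for this multiplicity.
\<close>

section \<open>Iterates of map sequences and Bowen distances\<close>

lemma seq_iter_map_prod:
  "seq_iter (\<lambda>i. map_prod (f i) (g i)) i j = map_prod (seq_iter f i j) (seq_iter g i j)"
  by (induction j) (auto simp: fun_eq_iff)

lemma continuous_map_seq_iter:
  assumes "\<And>k. i \<le> k \<Longrightarrow> continuous_map T T (f k)"
  shows "continuous_map T T (seq_iter f i j)"
proof (induction j)
  case (Suc j)
  then show ?case
    using continuous_map_compose[OF Suc assms[of "i + j"]] by (simp add: o_def)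
qed (simp add: continuous_map_id)

lemma seq_iter_closed:
  assumes "\<And>k. i \<le> k \<Longrightarrow> f k \<in> S \<rightarrow> S" "x \<in> S"
  shows "seq_iter f i j x \<in> S"
proof (induction j)
  case (Suc j)
  with assms(1)[of "i + j"] show ?case by auto
qed (use assms in simp)

text \<open>Positivity of \<open>n\<close> keeps the set under \<open>Max\<close> nonempty; at
  \<open>n = 0\<close> the maximum is unspecified.\<close>

lemma bowen_dist_le_iff:
  assumes "0 < n"
  shows "bowen_dist \<rho> g n x y \<le> \<epsilon> \<longleftrightarrow> (\<forall>j<n. \<rho> (seq_iter g 1 j x) (seq_iter g 1 j y) \<le> \<epsilon>)"
  using assms by (auto simp: bowen_dist_def lessThan_empty_iff)

section \<open>Comparison of covering masses\<close>

lemma infsum_UN_le_ennreal: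
  fixes h :: "'a \<Rightarrow> ennreal" and k :: "'b \<Rightarrow> ennreal"
  assumes fin: "\<And>s. s \<in> G \<Longrightarrow> finite (\<phi> s)"
    and le: "\<And>s. s \<in> G \<Longrightarrow> sum h (\<phi> s) \<le> k s"
  shows "(\<Sum>\<^sub>\<infinity>x\<in>(\<Union>s\<in>G. \<phi> s). h x) \<le> (\<Sum>\<^sub>\<infinity>s\<in>G. k s)"
proof -
  \<comment> \<open>A sum in \<open>ennreal\<close> is the supremum of its finite partial sums, so
    it is enough to bound these.\<close>
  have "sum h F \<le> (\<Sum>\<^sub>\<infinity>s\<in>G. k s)" if F: "finite F" "F \<subseteq> (\<Union>s\<in>G. \<phi> s)" for F
  proof -
    \<comment> \<open>The sets \<open>\<phi> s\<close> may overlap. Charging each \<open>x\<close>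
      to a single index \<open>s x\<close> splits \<open>F\<close> into disjoint fibres, each inside
      one \<open>\<phi> t\<close>.\<close>
    obtain s where s: "\<And>x. x \<in> F \<Longrightarrow> s x \<in> G \<and> x \<in> \<phi> (s x)"
      using F(2) by (metis UN_E subsetD)
    have "sum h F = (\<Sum>t\<in>s ` F. sum h {x \<in> F. s x = t})"
      by (rule sum.image_gen[OF F(1)])
    also have "\<dots> \<le> (\<Sum>t\<in>s ` F. k t)"
    proof (rule sum_mono)
      fix t assume "t \<in> s ` F"
      then have t: "t \<in> G" "{x \<in> F. s x = t} \<subseteq> \<phi> t" using s by blast+
      have "sum h {x \<in> F. s x = t} \<le> sum h (\<phi> t)"
        using t fin by (intro sum_mono2) auto
      with le[OF t(1)] show "sum h {x \<in> F. s x = t} \<le> k t" by order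
    qed
    also have "\<dots> = (\<Sum>\<^sub>\<infinity>t\<in>s ` F. k t)" using F(1) by simp
    also have "\<dots> \<le> (\<Sum>\<^sub>\<infinity>s\<in>G. k s)"
      using s by (intro infsum_mono_neutral) (auto intro: nonneg_summable_on_complete)
    finally show ?thesis .
  qed
  then show ?thesis
    by (subst nonneg_infsum_complete) (auto intro!: SUP_least)
qed

text \<open>A purely combinatorial comparison at one fixed \<open>N\<close>: compactness enters only
  through \<open>fine\<close> and \<open>span\<close>. As no limit in \<open>N\<close> is taken yet,
  it serves the lower and the upper mass alike.\<close>

lemma covering_mass_prod_le:
  fixes f :: "nat \<Rightarrow> 'a \<Rightarrow> 'a" and g :: "nat \<Rightarrow> 'b \<Rightarrow> 'b"
  assumes top: "topspace T = topspace S \<times> Y"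
    and g: "\<And>i. 1 \<le> i \<Longrightarrow> g i \<in> Y \<rightarrow> Y"
    and W: "W \<subseteq> Y"
    and fine: "\<And>U y. U \<in> \<U> \<Longrightarrow> y \<in> Y \<Longrightarrow> \<exists>V\<in>\<V>. U \<times> {y' \<in> Y. \<rho> y y' \<le> \<epsilon>} \<subseteq> V"
    and span: "\<And>n. N \<le> n \<Longrightarrow> \<exists>E. finite E \<and> E \<subseteq> Y \<and>
        (\<forall>y\<in>W. \<exists>x\<in>E. bowen_dist \<rho> g n x y \<le> \<epsilon>) \<and> real (card E) \<le> exp (c * real n)"
  shows "covering_mass T (\<lambda>i. map_prod (f i) (g i)) (Z \<times> W) (\<alpha> + c) \<V> N \<theta>
    \<le> covering_mass S f Z \<alpha> \<U> N \<theta>"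
  unfolding covering_mass_def
proof (rule INF_greatest)
  fix G
  assume "G \<in> {G. countable G \<and> G \<subseteq> admissible_strings \<U> N \<theta> \<and>
    Z \<subseteq> (\<Union>\<sigma>\<in>G. string_set S f \<sigma>)}"
  then have cG: "countable G" and aG: "G \<subseteq> admissible_strings \<U> N \<theta>"
    and ZG: "Z \<subseteq> (\<Union>\<sigma>\<in>G. string_set S f \<sigma>)" by auto
  obtain E where E: "\<And>n. N \<le> n \<Longrightarrow> finite (E n) \<and> E n \<subseteq> Y \<and>
      (\<forall>y\<in>W. \<exists>x\<in>E n. bowen_dist \<rho> g n x y \<le> \<epsilon>) \<and> real (card (E n)) \<le> exp (c * real n)"
    using span by metis
  obtain v where v: "\<And>U y. U \<in> \<U> \<Longrightarrow> y \<in> Y \<Longrightarrow>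
      v U y \<in> \<V> \<and> U \<times> {y' \<in> Y. \<rho> y y' \<le> \<epsilon>} \<subseteq> v U y"
    using fine by metis
  \<comment> \<open>Entry \<open>j\<close> of \<open>\<tau> \<sigma> e\<close> is a member of
    \<open>\<V>\<close> containing the product of \<open>\<sigma> ! j\<close> with the closed
    \<open>\<epsilon>\<close>-ball about the \<open>j\<close>-th iterate of \<open>e\<close>. Hence
    if \<open>x\<close> follows \<open>\<sigma>\<close> and \<open>y\<close> stays
    \<open>\<epsilon>\<close>-close to \<open>e\<close> for \<open>length \<sigma>\<close> steps,
    then \<open>(x, y)\<close> follows \<open>\<tau> \<sigma> e\<close>.\<close>
  define \<tau> where "\<tau> \<sigma> e = map (\<lambda>j. v (\<sigma> ! j) (seq_iter g 1 j e)) [0..<length \<sigma>]" for \<sigma> e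
  define \<phi> where "\<phi> \<sigma> = \<tau> \<sigma> ` E (length \<sigma>)" for \<sigma>
  have len_\<tau>: "length (\<tau> \<sigma> e) = length \<sigma>" for \<sigma> e by (simp add: \<tau>_def)
  have gY: "seq_iter g 1 j y \<in> Y" if "y \<in> Y" for j y
    using seq_iter_closed[of 1 g Y y j] g that by auto
  have G: "N \<le> length \<sigma>" "set \<sigma> \<subseteq> \<U>" "\<theta> = 0 \<or> real (length \<sigma>) < real N / \<theta> + 1"
    if "\<sigma> \<in> G" for \<sigma>
    using subsetD[OF aG that] by (auto simp: admissible_strings_def strings_def)
  let ?G' = "\<Union>\<sigma>\<in>G. \<phi> \<sigma>"
  have "countable ?G'"
    unfolding \<phi>_def using cG E[OF G(1)] by (intro countable_UN countable_image) (auto intro: countable_finite)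
  moreover have "?G' \<subseteq> admissible_strings \<V> N \<theta>"
  proof
    fix s assume "s \<in> ?G'"
    then obtain \<sigma> e where \<sigma>: "\<sigma> \<in> G" "e \<in> E (length \<sigma>)" "s = \<tau> \<sigma> e" by (auto simp: \<phi>_def)
    have "e \<in> Y" using E[OF G(1)[OF \<sigma>(1)]] \<sigma>(2) by auto
    then have "set s \<subseteq> \<V>"
      unfolding \<sigma>(3) \<tau>_def using G(2)[OF \<sigma>(1)] v gY by (fastforce dest: nth_mem)
    then show "s \<in> admissible_strings \<V> N \<theta>"
      using G(1,3)[OF \<sigma>(1)] len_\<tau>[of \<sigma> e] \<sigma>(3)
      by (simp add: admissible_strings_def strings_def)
  qed
  moreover have "Z \<times> W \<subseteq> (\<Union>s\<in>?G'. string_set T (\<lambda>i. map_prod (f i) (g i)) s)"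
  proof clarify
    fix x y assume "x \<in> Z" "y \<in> W"
    then obtain \<sigma> where \<sigma>: "\<sigma> \<in> G" "x \<in> string_set S f \<sigma>" using ZG by auto
    obtain e where e: "e \<in> E (length \<sigma>)" "bowen_dist \<rho> g (length \<sigma>) e y \<le> \<epsilon>"
      using E[OF G(1)[OF \<sigma>(1)]] \<open>y \<in> W\<close> by auto
    have Y: "e \<in> Y" "y \<in> Y" using E[OF G(1)[OF \<sigma>(1)]] e(1) \<open>y \<in> W\<close> W by auto
    have "seq_iter (\<lambda>i. map_prod (f i) (g i)) 1 j (x, y) \<in> \<tau> \<sigma> e ! j" if j: "j < length \<sigma>" for j
    proof -
      have "seq_iter f 1 j x \<in> \<sigma> ! j" using \<sigma>(2) j by (auto simp: string_set_def)
      \<comment> \<open>\<open>N = 0\<close> is allowed, so \<open>\<sigma>\<close> could be empty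
        in general; here \<open>j < length \<sigma>\<close> supplies the positive length that
        \<open>bowen_dist_le_iff\<close> asks for.\<close>
      moreover have "\<rho> (seq_iter g 1 j e) (seq_iter g 1 j y) \<le> \<epsilon>"
        using e(2) j bowen_dist_le_iff[of "length \<sigma>" \<rho> g e y \<epsilon>] by force
      moreover have "\<sigma> ! j \<in> \<U>" using G(2)[OF \<sigma>(1)] j by auto
      ultimately show ?thesis
        using v[of "\<sigma> ! j" "seq_iter g 1 j e"] gY Y j
        by (auto simp: seq_iter_map_prod \<tau>_def)
    qed
    then have "(x, y) \<in> string_set T (\<lambda>i. map_prod (f i) (g i)) (\<tau> \<sigma> e)"
      using \<sigma>(2) Y(2) by (auto simp: string_set_def top len_\<tau>)
    then show "(x, y) \<in> (\<Union>s\<in>?G'. string_set T (\<lambda>i. map_prod (f i) (g i)) s)"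
      using \<sigma>(1) e(1) by (auto simp: \<phi>_def)
  qed
  moreover have "(\<Sum>\<^sub>\<infinity>s\<in>?G'. ennreal (exp (- (\<alpha> + c) * real (length s))))
      \<le> (\<Sum>\<^sub>\<infinity>\<sigma>\<in>G. ennreal (exp (- \<alpha> * real (length \<sigma>))))"
  proof (rule infsum_UN_le_ennreal)
    fix \<sigma> assume "\<sigma> \<in> G"
    note E' = E[OF G(1)[OF this]]
    let ?m = "real (length \<sigma>)"
    show fin: "finite (\<phi> \<sigma>)" using E' by (simp add: \<phi>_def)
    have "(\<Sum>s\<in>\<phi> \<sigma>. exp (- (\<alpha> + c) * real (length s)))
        = real (card (\<phi> \<sigma>)) * exp (- (\<alpha> + c) * ?m)"
      unfolding sum_constant[symmetric] by (rule sum.cong) (auto simp: \<phi>_def len_\<tau>)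
    \<comment> \<open>Different \<open>e\<close> may yield the same string, so the image
      \<open>\<phi> \<sigma>\<close> has at most as many elements as
      \<open>E (length \<sigma>)\<close>; \<open>span\<close> bounds that number.\<close>
    also have "\<dots> \<le> exp (c * ?m) * exp (- (\<alpha> + c) * ?m)"
      using E' card_image_le[of "E (length \<sigma>)" "\<tau> \<sigma>"]
      by (intro mult_right_mono) (auto simp: \<phi>_def)
    also have "\<dots> = exp (- \<alpha> * ?m)"
      by (simp add: algebra_simps flip: exp_add)
    finally show "(\<Sum>s\<in>\<phi> \<sigma>. ennreal (exp (- (\<alpha> + c) * real (length s))))
        \<le> ennreal (exp (- \<alpha> * ?m))"
      by (simp add: sum_ennreal ennreal_leI)
  qed
  ultimately show "(INF H\<in>{H. countable H \<and> H \<subseteq> admissible_strings \<V> N \<theta> \<and>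
        Z \<times> W \<subseteq> (\<Union>s\<in>H. string_set T (\<lambda>i. map_prod (f i) (g i)) s)}.
      \<Sum>\<^sub>\<infinity>s\<in>H. ennreal (exp (- (\<alpha> + c) * real (length s))))
    \<le> (\<Sum>\<^sub>\<infinity>\<sigma>\<in>G. ennreal (exp (- \<alpha> * real (length \<sigma>))))"
    by (intro INF_lower2[of ?G']) auto
qed

section \<open>The topology of the maximum metric\<close>

lemma mtopology_max_dist:
  assumes "Metric_space X d" "Metric_space Y \<rho>"
  shows "Metric_space.mtopology (X \<times> Y) (max_dist d \<rho>)
    = prod_topology (Metric_space.mtopology X d) (Metric_space.mtopology Y \<rho>)"
proof -
  interpret X: Metric_space X d by fact
  interpret Y: Metric_space Y \<rho> by fact
  interpret XY: Metric_space "X \<times> Y" "max_dist d \<rho>"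
    using Metric_space_max_dist assms by blast
  \<comment> \<open>Balls of the maximum metric are products of balls of equal radius, so they form
    boxes; conversely, a box around a point contains such a ball, with the smaller of two
    radii.\<close>
  have ball: "XY.mball (x, y) r = X.mball x r \<times> Y.mball y r" for x y r
    by (auto simp: XY.mball_def X.mball_def Y.mball_def max_dist_def)
  have "openin XY.mtopology S \<longleftrightarrow> openin (prod_topology X.mtopology Y.mtopology) S" for S
  proof
    assume S: "openin XY.mtopology S"
    show "openin (prod_topology X.mtopology Y.mtopology) S"
      unfolding openin_prod_topology_alt
    proof (intro allI impI)
      fix x y assume xy: "(x, y) \<in> S"
      then obtain r where "r > 0" "XY.mball (x, y) r \<subseteq> S"
        using S by (metis XY.openin_mtopology)
      moreover have "x \<in> X" "y \<in> Y" using xy S XY.openin_mtopology by auto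
      ultimately show "\<exists>U V. openin X.mtopology U \<and> openin Y.mtopology V \<and>
          x \<in> U \<and> y \<in> V \<and> U \<times> V \<subseteq> S"
        unfolding ball by (intro exI[of _ "X.mball x r"] exI[of _ "Y.mball y r"]) auto
    qed
  next
    assume S: "openin (prod_topology X.mtopology Y.mtopology) S"
    have "\<exists>r>0. XY.mball (x, y) r \<subseteq> S" if xy: "(x, y) \<in> S" for x y
    proof -
      obtain U V where UV: "openin X.mtopology U" "openin Y.mtopology V" "x \<in> U" "y \<in> V"
          "U \<times> V \<subseteq> S"
        using S[unfolded openin_prod_topology_alt, rule_format, OF xy] by (elim exE conjE)
      obtain a where a: "a > 0" "X.mball x a \<subseteq> U"
        using UV(1,3) unfolding X.openin_mtopology by blast
      obtain b where b: "b > 0" "Y.mball y b \<subseteq> V"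
        using UV(2,4) unfolding Y.openin_mtopology by blast
      have "X.mball x (min a b) \<subseteq> X.mball x a" "Y.mball y (min a b) \<subseteq> Y.mball y b" by auto
      then have "XY.mball (x, y) (min a b) \<subseteq> S"
        unfolding ball using a b UV(5) by blast
      with a b show ?thesis by (intro exI[of _ "min a b"]) auto
    qed
    moreover have "S \<subseteq> X \<times> Y" using openin_subset[OF S] by simp
    ultimately show "openin XY.mtopology S" unfolding XY.openin_mtopology by auto
  qed
  then show ?thesis by (simp add: topology_eq)
qed

section \<open>Spanning numbers and their growth rate\<close>

lemma ex_finite_spanning_set:
  assumes "Metric_space Y \<rho>" "compact_space (Metric_space.mtopology Y \<rho>)"
    and g: "\<forall>i\<ge>1. continuous_map (Metric_space.mtopology Y \<rho>) (Metric_space.mtopology Y \<rho>) (g i)"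
    and "0 < n" "0 < \<epsilon>"
  shows "\<exists>E. finite E \<and> E \<subseteq> Y \<and> (\<forall>y\<in>Y. \<exists>x\<in>E. bowen_dist \<rho> g n x y \<le> \<epsilon>)"
proof -
  interpret Y: Metric_space Y \<rho> by fact
  let ?g = "seq_iter g 1"
  have cont: "continuous_map Y.mtopology Y.mtopology (?g j)" for j
    using continuous_map_seq_iter[of 1 Y.mtopology g j] g by blast
  \<comment> \<open>\<open>B x\<close> is the open Bowen ball of radius \<open>\<epsilon>\<close>
    about \<open>x\<close>, open as a finite intersection of preimages under continuous iterates.
    The centres of a finite subcover form a spanning set.\<close>
  define B where "B x = (\<Inter>j<n. {y \<in> Y. ?g j y \<in> Y.mball (?g j x) \<epsilon>})" for x
  have "openin Y.mtopology (B x)" for x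
    unfolding B_def using openin_continuous_map_preimage[OF cont Y.openin_mball] \<open>0 < n\<close>
    by (intro openin_INT2) auto
  moreover have "x \<in> B x" if "x \<in> Y" for x
    using continuous_map_funspace[OF cont] that \<open>0 < \<epsilon>\<close> by (fastforce simp: B_def Pi_iff)
  ultimately obtain \<F> where \<F>: "finite \<F>" "\<F> \<subseteq> B ` Y" "Y \<subseteq> \<Union>\<F>"
    using assms(2) unfolding compact_space_alt
    by (metis (no_types, lifting) UN_I Y.topspace_mtopology imageE subsetI)
  then obtain E where E: "E \<subseteq> Y" "finite E" "\<F> = B ` E"
    by (meson finite_subset_image)
  have "\<exists>x\<in>E. bowen_dist \<rho> g n x y \<le> \<epsilon>" if y: "y \<in> Y" for y
  proof -
    obtain x where "x \<in> E" "y \<in> B x" using \<F>(3) E(3) y by blast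
    then show ?thesis
      using \<open>0 < n\<close> by (force simp: bowen_dist_le_iff B_def)
  qed
  with E show ?thesis by blast
qed

text \<open>A finite spanning set for \<open>Y\<close> also spans \<open>W\<close>, so the infimum
  is over a nonempty set of naturals and is therefore attained.\<close>

lemma spanning_number_attained:
  assumes "Metric_space Y \<rho>" "compact_space (Metric_space.mtopology Y \<rho>)"
    and "\<forall>i\<ge>1. continuous_map (Metric_space.mtopology Y \<rho>) (Metric_space.mtopology Y \<rho>) (g i)"
    and "W \<subseteq> Y" "0 < n" "0 < \<epsilon>"
  obtains E where "finite E" "E \<subseteq> Y" "\<forall>y\<in>W. \<exists>x\<in>E. bowen_dist \<rho> g n x y \<le> \<epsilon>"
    "card E = spanning_number Y \<rho> g W n \<epsilon>"
proof -
  let ?\<E> = "{E. finite E \<and> E \<subseteq> Y \<and> (\<forall>y\<in>W. \<exists>x\<in>E. bowen_dist \<rho> g n x y \<le> \<epsilon>)}"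
  obtain E where "finite E" "E \<subseteq> Y" "\<forall>y\<in>Y. \<exists>x\<in>E. bowen_dist \<rho> g n x y \<le> \<epsilon>"
    using ex_finite_spanning_set[OF assms(1-3,5,6)] by (elim exE conjE)
  then have "E \<in> ?\<E>" using \<open>W \<subseteq> Y\<close> by (simp add: subset_iff)
  then have "Inf (card ` ?\<E>) \<in> card ` ?\<E>"
    by (intro Inf_nat_def1) (metis (lifting) empty_iff imageI)
  then obtain F where "F \<in> ?\<E>" "Inf (card ` ?\<E>) = card F" by (rule imageE)
  then show ?thesis by (intro that[of F]) (auto simp: spanning_number_def)
qed

lemma spanning_number_le:
  assumes "finite E" "E \<subseteq> Y" "\<forall>y\<in>W. \<exists>x\<in>E. bowen_dist \<rho> g n x y \<le> \<epsilon>"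
  shows "spanning_number Y \<rho> g W n \<epsilon> \<le> card E"
  unfolding spanning_number_def by (rule cInf_lower) (use assms in auto)

text \<open>The inner upper limit of \<open>classical_entropy\<close>, isolated because the
  estimates are made at one fixed scale.\<close>

definition spanning_rate ::
    "'a set \<Rightarrow> ('a \<Rightarrow> 'a \<Rightarrow> real) \<Rightarrow> (nat \<Rightarrow> 'a \<Rightarrow> 'a) \<Rightarrow> 'a set \<Rightarrow> real \<Rightarrow> ereal" where
  "spanning_rate Y \<rho> g W \<epsilon> =
     limsup (\<lambda>n. ereal (1 / real n * ln (real (spanning_number Y \<rho> g W n \<epsilon>))))"

text \<open>The case \<open>n = 0\<close> is covered by the convention
  \<open>ln 0 = 0\<close>.\<close>

lemma ln_of_nat_nonneg: "0 \<le> ln (real n)"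
  by (cases n) auto

lemma spanning_rate_nonneg: "0 \<le> spanning_rate Y \<rho> g W \<epsilon>"
  unfolding spanning_rate_def
  by (rule le_Limsup) (auto simp: ln_of_nat_nonneg)

text \<open>A set that spans at scale \<open>\<delta>\<close> also spans at every larger scale
  \<open>\<epsilon>\<close>.\<close>

lemma spanning_rate_antimono:
  assumes "Metric_space Y \<rho>" "compact_space (Metric_space.mtopology Y \<rho>)"
    and "\<forall>i\<ge>1. continuous_map (Metric_space.mtopology Y \<rho>) (Metric_space.mtopology Y \<rho>) (g i)"
    and W: "W \<noteq> {}" "W \<subseteq> Y" and \<epsilon>: "0 < \<delta>" "\<delta> \<le> \<epsilon>"
  shows "spanning_rate Y \<rho> g W \<epsilon> \<le> spanning_rate Y \<rho> g W \<delta>"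
  unfolding spanning_rate_def
proof (rule Limsup_mono, rule eventually_sequentiallyI[of 1])
  fix n :: nat assume n: "1 \<le> n"
  let ?r = "spanning_number Y \<rho> g W n"
  have "0 < n" "0 < \<epsilon>" using n \<epsilon> by auto
  obtain E where E: "finite E" "E \<subseteq> Y" "\<forall>y\<in>W. \<exists>x\<in>E. bowen_dist \<rho> g n x y \<le> \<delta>"
      "card E = ?r \<delta>"
    by (rule spanning_number_attained[OF assms(1-3) W(2) \<open>0 < n\<close> \<epsilon>(1)])
  obtain F where F: "finite F" "F \<subseteq> Y" "\<forall>y\<in>W. \<exists>x\<in>F. bowen_dist \<rho> g n x y \<le> \<epsilon>"
      "card F = ?r \<epsilon>"
    by (rule spanning_number_attained[OF assms(1-3) W(2) \<open>0 < n\<close> \<open>0 < \<epsilon>\<close>])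
  have "?r \<epsilon> \<le> ?r \<delta>"
    using E \<epsilon>(2) spanning_number_le[of E Y W \<rho> g n \<epsilon>] by (metis order_trans)
  \<comment> \<open>A nonempty \<open>W\<close> cannot be spanned by the empty set; so
    \<open>ln\<close> is applied to positive numbers, where it is increasing.\<close>
  moreover have "0 < ?r \<epsilon>"
    using F W(1) by (metis all_not_in_conv card_gt_0_iff)
  ultimately show "ereal (1 / real n * ln (real (?r \<epsilon>))) \<le> ereal (1 / real n * ln (real (?r \<delta>)))"
    by (auto intro!: divide_right_mono)
qed

lemma spanning_rate_le_classical_entropy:
  assumes "Metric_space Y \<rho>" "compact_space (Metric_space.mtopology Y \<rho>)"
    and "\<forall>i\<ge>1. continuous_map (Metric_space.mtopology Y \<rho>) (Metric_space.mtopology Y \<rho>) (g i)"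
    and "W \<noteq> {}" "W \<subseteq> Y" and "0 < \<epsilon>"
  shows "spanning_rate Y \<rho> g W \<epsilon> \<le> classical_entropy Y \<rho> g W"
proof -
  let ?h = "spanning_rate Y \<rho> g W"
  let ?L = "SUP \<epsilon>\<in>{0<..}. ?h \<epsilon>"
  \<comment> \<open>\<open>Lim\<close> is a description operator, so its value is available only
    once convergence is proved. An antitone function converges at \<open>0\<close> from the right to
    its supremum, and this supremum bounds the rate at every scale.\<close>
  have "(?h \<longlongrightarrow> ?L) (at_right 0)"
  proof (rule order_tendstoI)
    fix a assume "a < ?L"
    then obtain \<epsilon> where \<epsilon>: "0 < \<epsilon>" "a < ?h \<epsilon>" by (auto simp: less_SUP_iff)
    have "a < ?h \<delta>" if "0 < \<delta>" "\<delta> < \<epsilon>" for \<delta>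
      using less_le_trans[OF \<epsilon>(2) spanning_rate_antimono[OF assms(1-5)]] that by simp
    then show "\<forall>\<^sub>F \<delta> in at_right 0. a < ?h \<delta>"
      unfolding eventually_at_right_field using \<epsilon>(1) by blast
  next
    fix a assume "?L < a"
    have "?h \<delta> < a" if "0 < \<delta>" for \<delta>
      using \<open>?L < a\<close> that by (meson SUP_upper greaterThan_iff le_less_trans)
    then show "\<forall>\<^sub>F \<delta> in at_right 0. ?h \<delta> < a"
      by (auto simp: eventually_at_right_field intro: exI[of _ 1])
  qed
  then have "classical_entropy Y \<rho> g W = ?L"
    unfolding classical_entropy_def spanning_rate_def[symmetric]
    by (intro tendsto_Lim) auto
  then show ?thesis using \<open>0 < \<epsilon>\<close> by (auto intro: SUP_upper)
qed

lemma eventually_spanning_set: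
  assumes "Metric_space Y \<rho>" "compact_space (Metric_space.mtopology Y \<rho>)"
    and "\<forall>i\<ge>1. continuous_map (Metric_space.mtopology Y \<rho>) (Metric_space.mtopology Y \<rho>) (g i)"
    and "W \<subseteq> Y" and "0 < \<epsilon>" and c: "spanning_rate Y \<rho> g W \<epsilon> < ereal c"
  shows "\<forall>\<^sub>F n in sequentially. \<exists>E. finite E \<and> E \<subseteq> Y \<and>
    (\<forall>y\<in>W. \<exists>x\<in>E. bowen_dist \<rho> g n x y \<le> \<epsilon>) \<and> real (card E) \<le> exp (c * real n)"
proof -
  have "\<forall>\<^sub>F n in sequentially. ereal (1 / real n * ln (real (spanning_number Y \<rho> g W n \<epsilon>))) < ereal c"
    using c unfolding spanning_rate_def by (rule Limsup_lessD)
  then show ?thesis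
    using eventually_gt_at_top[of 0]
  proof eventually_elim
    case (elim n)
    obtain F where F: "finite F" "F \<subseteq> Y" "\<forall>y\<in>W. \<exists>x\<in>F. bowen_dist \<rho> g n x y \<le> \<epsilon>"
        "card F = spanning_number Y \<rho> g W n \<epsilon>"
      by (rule spanning_number_attained[OF assms(1-4) elim(2) \<open>0 < \<epsilon>\<close>])
    have ln: "ln (real (card F)) < c * real n"
      using elim F(4) by (simp add: field_simps)
    have "real (card F) \<le> exp (c * real n)"
    \<comment> \<open>\<open>W\<close> may be empty here, which makes the spanning number
      \<open>0\<close>; \<open>exp\<close> inverts \<open>ln\<close> only at positive
      arguments.\<close>
    proof (cases "card F = 0")
      case False
      then show ?thesis using ln
        by (metis exp_ln less_eq_real_def exp_less_mono of_nat_0_less_iff not_gr_zero)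
    qed simp
    with F show ?case by (intro exI[of _ F]) simp
  qed
qed

section \<open>From masses to entropies\<close>

lemma INF_ereal_le_add:
  fixes m m' :: "real \<Rightarrow> ennreal" and h :: ereal
  assumes "0 \<le> h" and step: "\<And>\<alpha> c. h < ereal c \<Longrightarrow> m' (\<alpha> + c) \<le> m \<alpha>"
  shows "(INF \<alpha>\<in>{\<alpha>. 0 \<le> \<alpha> \<and> m' \<alpha> = 0}. ereal \<alpha>) \<le> (INF \<alpha>\<in>{\<alpha>. 0 \<le> \<alpha> \<and> m \<alpha> = 0}. ereal \<alpha>) + h"
    (is "?I' \<le> ?I + h")
\<comment> \<open>Both summands on the right are nonnegative, so if one is infinite the sum is.
  Otherwise \<open>h\<close> is real and can be moved across the inequality, leaving
  \<open>?I\<close> alone as a greatest lower bound.\<close>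
proof (cases "h = \<infinity> \<or> ?I = \<infinity>")
  case True
  have "0 \<le> ?I" by (rule INF_greatest) auto
  with True \<open>0 \<le> h\<close> show ?thesis by auto
next
  case False
  then obtain r where r: "h = ereal r" using \<open>0 \<le> h\<close> by (cases h) auto
  have "?I' - h \<le> ?I"
  proof (rule INF_greatest)
    fix \<alpha> assume \<alpha>: "\<alpha> \<in> {\<alpha>. 0 \<le> \<alpha> \<and> m \<alpha> = 0}"
    \<comment> \<open>\<open>step\<close> demands \<open>c\<close> strictly above \<open>h\<close>;
      take \<open>c = r + e\<close> and let \<open>e\<close> tend to \<open>0\<close>.\<close>
    have "?I' \<le> ereal (\<alpha> + r) + ereal e" if "0 < e" for e
    proof -
      have "m' (\<alpha> + (r + e)) = 0" using step[of "r + e" \<alpha>] r that \<alpha> by auto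
      then have "?I' \<le> ereal (\<alpha> + (r + e))"
        using \<alpha> r \<open>0 \<le> h\<close> that by (intro INF_lower) auto
      then show ?thesis by (simp add: add.assoc)
    qed
    then have "?I' \<le> ereal (\<alpha> + r)" by (rule ereal_le_epsilon2)
    then show "?I' - h \<le> ereal \<alpha>" unfolding r by (simp add: ereal_minus_le)
  qed
  then show ?thesis unfolding r by (simp add: ereal_minus_le)
qed

lemma prod_cover_refinement:
  assumes "Metric_space X d" "compact_space (Metric_space.mtopology X d)"
    and "Metric_space Y \<rho>" "compact_space (Metric_space.mtopology Y \<rho>)"
    and \<V>: "finite_open_cover (Metric_space.mtopology (X \<times> Y) (max_dist d \<rho>)) \<V>"
  shows "\<exists>\<U> \<epsilon>. finite_open_cover (Metric_space.mtopology X d) \<U> \<and> 0 < \<epsilon> \<and>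
    (\<forall>U\<in>\<U>. \<forall>y\<in>Y. \<exists>V\<in>\<V>. U \<times> {y' \<in> Y. \<rho> y y' \<le> \<epsilon>} \<subseteq> V)"
proof -
  interpret X: Metric_space X d by fact
  interpret Y: Metric_space Y \<rho> by fact
  interpret XY: Metric_space "X \<times> Y" "max_dist d \<rho>"
    using Metric_space_max_dist assms by blast
  have "compact_space XY.mtopology"
    using assms by (simp add: mtopology_max_dist compact_space_prod_topology)
  then have "compactin XY.mtopology (X \<times> Y)" by (simp add: compact_space_def)
  \<comment> \<open>\<open>r\<close> is a Lebesgue number of \<open>\<V>\<close>; the cover of
    \<open>X\<close> consists of balls of this radius.\<close>
  then obtain r where r: "r > 0" "\<And>p. p \<in> X \<times> Y \<Longrightarrow> \<exists>V\<in>\<V>. XY.mball p r \<subseteq> V"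
    using XY.lebesgue_number[of "X \<times> Y" \<V>] \<V> by (auto simp: finite_open_cover_def)
  have "X \<subseteq> \<Union>((\<lambda>x. X.mball x r) ` X)" using r(1) by auto
  then obtain \<U> where \<U>: "finite \<U>" "\<U> \<subseteq> (\<lambda>x. X.mball x r) ` X" "X \<subseteq> \<Union>\<U>"
    using assms(2) unfolding compact_space_alt X.topspace_mtopology
    by (metis (no_types, lifting) X.openin_mball imageE)
  have "finite_open_cover X.mtopology \<U>"
    using \<U> by (auto simp: finite_open_cover_def)
  \<comment> \<open>Spanning uses closed balls, while the Lebesgue number speaks of open ones; the
    radius \<open>r / 2\<close> lies strictly below \<open>r\<close>.\<close>
  moreover have "\<exists>V\<in>\<V>. U \<times> {y' \<in> Y. \<rho> y y' \<le> r / 2} \<subseteq> V" if U: "U \<in> \<U>" and y: "y \<in> Y" for U y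
  proof -
    obtain x where x: "x \<in> X" "U = X.mball x r" using \<U>(2) U by blast
    have "U \<times> {y' \<in> Y. \<rho> y y' \<le> r / 2} \<subseteq> XY.mball (x, y) r"
      using x y r(1) by (auto simp: max_dist_def)
    with r(2)[of "(x, y)"] x y show ?thesis by blast
  qed
  ultimately show ?thesis using r(1) by (intro exI[of _ \<U>] exI[of _ "r / 2"]) auto
qed

text \<open>One \<open>\<U>\<close> serves both inequalities, since the masses are compared for
  every large \<open>N\<close> before either limit is taken.\<close>

lemma entropy_cover_prod_le:
  fixes f :: "nat \<Rightarrow> 'a \<Rightarrow> 'a" and g :: "nat \<Rightarrow> 'b \<Rightarrow> 'b"
  assumes "Metric_space X d" "compact_space (Metric_space.mtopology X d)"
    and "Metric_space Y \<rho>" "compact_space (Metric_space.mtopology Y \<rho>)"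
    and g: "\<forall>i\<ge>1. continuous_map (Metric_space.mtopology Y \<rho>) (Metric_space.mtopology Y \<rho>) (g i)"
    and W: "W \<noteq> {}" "W \<subseteq> Y"
    and \<V>: "finite_open_cover (Metric_space.mtopology (X \<times> Y) (max_dist d \<rho>)) \<V>"
  shows "\<exists>\<U>. finite_open_cover (Metric_space.mtopology X d) \<U> \<and>
      lower_entropy_cover (Metric_space.mtopology (X \<times> Y) (max_dist d \<rho>))
        (\<lambda>i. map_prod (f i) (g i)) (Z \<times> W) \<V> \<theta>
      \<le> lower_entropy_cover (Metric_space.mtopology X d) f Z \<U> \<theta> + classical_entropy Y \<rho> g W \<and>
      upper_entropy_cover (Metric_space.mtopology (X \<times> Y) (max_dist d \<rho>))
        (\<lambda>i. map_prod (f i) (g i)) (Z \<times> W) \<V> \<theta>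
      \<le> upper_entropy_cover (Metric_space.mtopology X d) f Z \<U> \<theta> + classical_entropy Y \<rho> g W"
proof -
  interpret X: Metric_space X d by fact
  interpret Y: Metric_space Y \<rho> by fact
  interpret XY: Metric_space "X \<times> Y" "max_dist d \<rho>"
    using Metric_space_max_dist assms by blast
  let ?fg = "\<lambda>i. map_prod (f i) (g i)"
  obtain \<U> \<epsilon> where \<U>: "finite_open_cover X.mtopology \<U>" and \<epsilon>: "0 < \<epsilon>"
    and fine: "\<And>U y. U \<in> \<U> \<Longrightarrow> y \<in> Y \<Longrightarrow> \<exists>V\<in>\<V>. U \<times> {y' \<in> Y. \<rho> y y' \<le> \<epsilon>} \<subseteq> V"
    using prod_cover_refinement[OF assms(1-4) \<V>] by metis
  let ?h = "spanning_rate Y \<rho> g W \<epsilon>"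
  have ev: "\<forall>\<^sub>F N in sequentially. covering_mass XY.mtopology ?fg (Z \<times> W) (\<alpha> + c) \<V> N \<theta>
      \<le> covering_mass X.mtopology f Z \<alpha> \<U> N \<theta>" if c: "?h < ereal c" for \<alpha> c
  proof -
    \<comment> \<open>A single family may contain strings of many lengths \<open>n \<ge> N\<close>,
      so the bound on spanning sets is needed at all of them simultaneously.\<close>
    have "\<forall>\<^sub>F N in sequentially. \<forall>n\<ge>N. \<exists>E. finite E \<and> E \<subseteq> Y \<and>
        (\<forall>y\<in>W. \<exists>x\<in>E. bowen_dist \<rho> g n x y \<le> \<epsilon>) \<and> real (card E) \<le> exp (c * real n)"
      using eventually_spanning_set[OF assms(3,4) g W(2) \<epsilon> c]
      by (rule eventually_all_ge_at_top)
    then show ?thesis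
    proof eventually_elim
      case (elim N)
      show ?case
      proof (rule covering_mass_prod_le[where Y = Y and \<rho> = \<rho> and \<epsilon> = \<epsilon>])
        show "g i \<in> Y \<rightarrow> Y" if "1 \<le> i" for i
          using continuous_map_funspace[OF g[rule_format, OF that]] by simp
      qed (use elim fine W in auto)
    qed
  qed
  have h: "?h \<le> classical_entropy Y \<rho> g W"
    by (rule spanning_rate_le_classical_entropy[OF assms(3,4) g W \<epsilon>])
  have "lower_entropy_cover XY.mtopology ?fg (Z \<times> W) \<V> \<theta>
      \<le> lower_entropy_cover X.mtopology f Z \<U> \<theta> + ?h"
    unfolding lower_entropy_cover_def lower_mass_def
    by (rule INF_ereal_le_add[OF spanning_rate_nonneg]) (intro Liminf_mono ev)
  moreover have "upper_entropy_cover XY.mtopology ?fg (Z \<times> W) \<V> \<theta>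
      \<le> upper_entropy_cover X.mtopology f Z \<U> \<theta> + ?h"
    unfolding upper_entropy_cover_def upper_mass_def
    by (rule INF_ereal_le_add[OF spanning_rate_nonneg]) (intro Limsup_mono ev)
  ultimately show ?thesis
    using \<U> h by (meson add_left_mono order_trans)
qed

theorem proposition3p9:
  fixes X :: "'a set" and d :: "'a \<Rightarrow> 'a \<Rightarrow> real" and f :: "nat \<Rightarrow> 'a \<Rightarrow> 'a"
    and Y :: "'b set" and \<rho> :: "'b \<Rightarrow> 'b \<Rightarrow> real" and g :: "nat \<Rightarrow> 'b \<Rightarrow> 'b"
    and Z :: "'a set" and W :: "'b set" and \<theta> :: real
  assumes "Metric_space X d" and "compact_space (Metric_space.mtopology X d)"
    and "Metric_space Y \<rho>" and "compact_space (Metric_space.mtopology Y \<rho>)"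
    and "\<And>i. 1 \<le> i \<Longrightarrow>
      continuous_map (Metric_space.mtopology X d) (Metric_space.mtopology X d) (f i)"
    and "\<And>i. 1 \<le> i \<Longrightarrow>
      continuous_map (Metric_space.mtopology Y \<rho>) (Metric_space.mtopology Y \<rho>) (g i)"
    and "Z \<noteq> {}" and "Z \<subseteq> X" and "W \<noteq> {}" and "W \<subseteq> Y"
    and "0 \<le> \<theta>" and "\<theta> \<le> 1"
  shows "lower_entropy (Metric_space.mtopology (X \<times> Y) (max_dist d \<rho>))
            (\<lambda>i. map_prod (f i) (g i)) (Z \<times> W) \<theta>
          \<le> lower_entropy (Metric_space.mtopology X d) f Z \<theta> + classical_entropy Y \<rho> g W
       \<and> upper_entropy (Metric_space.mtopology (X \<times> Y) (max_dist d \<rho>))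
            (\<lambda>i. map_prod (f i) (g i)) (Z \<times> W) \<theta>
          \<le> upper_entropy (Metric_space.mtopology X d) f Z \<theta> + classical_entropy Y \<rho> g W"
proof -
  have "\<forall>i\<ge>1. continuous_map (Metric_space.mtopology Y \<rho>) (Metric_space.mtopology Y \<rho>) (g i)"
    using assms(6) by blast
  note cover = entropy_cover_prod_le[OF assms(1-4) this assms(9,10)]
  show ?thesis
    unfolding lower_entropy_def upper_entropy_def
  \<comment> \<open>Every cover of the product is dominated by some cover of \<open>X\<close> up to
    a summand independent of the covers, so the bound passes to the suprema.\<close>
  proof (intro conjI SUP_least)
    fix \<V> assume "\<V> \<in> {\<V>. finite_open_cover (Metric_space.mtopology (X \<times> Y) (max_dist d \<rho>)) \<V>}"
    then have "finite_open_cover (Metric_space.mtopology (X \<times> Y) (max_dist d \<rho>)) \<V>" by simp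
    then obtain \<U> where \<U>: "finite_open_cover (Metric_space.mtopology X d) \<U>"
      and le: "lower_entropy_cover (Metric_space.mtopology (X \<times> Y) (max_dist d \<rho>))
          (\<lambda>i. map_prod (f i) (g i)) (Z \<times> W) \<V> \<theta>
        \<le> lower_entropy_cover (Metric_space.mtopology X d) f Z \<U> \<theta> + classical_entropy Y \<rho> g W"
      using cover[of \<V> f Z \<theta>] by (elim meta_impE exE conjE)
    show "lower_entropy_cover (Metric_space.mtopology (X \<times> Y) (max_dist d \<rho>))
          (\<lambda>i. map_prod (f i) (g i)) (Z \<times> W) \<V> \<theta>
        \<le> (SUP \<U>\<in>{\<U>. finite_open_cover (Metric_space.mtopology X d) \<U>}.
            lower_entropy_cover (Metric_space.mtopology X d) f Z \<U> \<theta>) + classical_entropy Y \<rho> g W"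
      using \<U> by (intro order_trans[OF le] add_right_mono SUP_upper) simp
  next
    fix \<V> assume "\<V> \<in> {\<V>. finite_open_cover (Metric_space.mtopology (X \<times> Y) (max_dist d \<rho>)) \<V>}"
    then have "finite_open_cover (Metric_space.mtopology (X \<times> Y) (max_dist d \<rho>)) \<V>" by simp
    then obtain \<U> where \<U>: "finite_open_cover (Metric_space.mtopology X d) \<U>"
      and le: "upper_entropy_cover (Metric_space.mtopology (X \<times> Y) (max_dist d \<rho>))
          (\<lambda>i. map_prod (f i) (g i)) (Z \<times> W) \<V> \<theta>
        \<le> upper_entropy_cover (Metric_space.mtopology X d) f Z \<U> \<theta> + classical_entropy Y \<rho> g W"
      using cover[of \<V> f Z \<theta>] by (elim meta_impE exE conjE)
    show "upper_entropy_cover (Metric_space.mtopology (X \<times> Y) (max_dist d \<rho>))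
          (\<lambda>i. map_prod (f i) (g i)) (Z \<times> W) \<V> \<theta>
        \<le> (SUP \<U>\<in>{\<U>. finite_open_cover (Metric_space.mtopology X d) \<U>}.
            upper_entropy_cover (Metric_space.mtopology X d) f Z \<U> \<theta>) + classical_entropy Y \<rho> g W"
      using \<U> by (intro order_trans[OF le] add_right_mono SUP_upper) simp
  qed
qed

end
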